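(* The correspondence $(T,f)\mapsto T^*f$, where $f\in\mathrm{SR}(\Omega,\mathbb H)$ for a symmetric slice domain $\Omega$, $T\in\mathrm{GL}(2,\mathbb H)$ is $f$-admissible, and $T^*f\in\mathrm{SR}(\Omega,\mathbb H)$ is the unique slice-regular function with $G_{T^*f}=T\cdot G_f$, defines a partial left action of $\mathrm{GL}(2,\mathbb H)$ on the class of slice-regular functions on symmetric slice domains: whenever both sides are well-defined, one has $$(ST)^*f=S^*(T^*f),\qquad I^*f=f,$$ where $S,T\in\mathrm{GL}(2,\mathbb H)$ and $I$ is the identity matrix.
   Context: $\mathbb H$ denotes the quaternions and $\mathbb S=\{q\in\mathbb H: q^2=-1\}$. Fix $i,j\in\mathbb S$ with $ij=-ji$, and put $\mathbb C:=\mathbb R+\mathbb R i\subset\mathbb H$, $\mathbb C^+:=\{x+yi:y>0\}$. A symmetric slice domain is a domain $\Omega\subset\mathbb H$ with $\Omega\cap\mathbb R\ne\emptyset$, with $\Omega_I:=\Omega\cap(\mathbb R+\mathbb R I)$ a domain in $\mathbb R+\mathbb R I$ for all $I\in\mathbb S$, and such that $x+yI\in\Omega$ implies $x+yI'\in\Omega$ for all $x,y\in\mathbb R$ and $I,I'\in\mathbb S$. Put $V:=\Omega\cap\mathbb C^+$. A function $f:\Omega\to\mathbb H$ is slice regular if for every $I\in\mathbb S$ the restriction $f|_{\Omega_I}$ is holomorphic for left multiplication by $I$, i.e. $\frac12(\partial_x+I\partial_y)f(x+yI)=0$; $\mathrm{SR}(\Omega,\mathbb H)$ is the set of such functions. For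 $f\in\mathrm{SR}(\Omega,\mathbb H)$ write $f(z)=g(z)+h(z)j$ for $z\in\Omega_i$ with $g,h:\Omega_i\to\mathbb C$ holomorphic, put $\hat g(z)=\overline{g(\overline z)}$, $\hat h(z)=\overline{h(\overline z)}$, and $$\Phi_f(z)=\begin{pmatrix} g(z) & -\hat h(z) \\ h(z) & \hat g(z) \end{pmatrix}.$$ For $\Phi\in\mathrm{Mat}_{2\times2}(\mathbb C)$ let $L(\Phi)=\{(x,\Phi x):x\in\mathbb C^2\}\in\mathrm{Gr}_2(\mathbb C^4)$, and let $\mathcal U_6=\{L(\Phi):\Phi\in\mathrm{Mat}_{2\times2}(\mathbb C)\}\subset\mathrm{Gr}_2(\mathbb C^4)$ be the affine chart of all such graphs (the planes that project isomorphically onto the first summand of $\mathbb C^4=\mathbb C^2\oplus\mathbb C^2$). The twistor transform of $f$ is the holomorphic curve $G_f:V\to\mathrm{Gr}_2(\mathbb C^4)$, $G_f(v)=L(\Phi_f(v))$. $\mathrm{GL}(2,\mathbb H)\subset\mathrm{GL}(4,\mathbb C)$ is the group of invertible matrices $\begin{pmatrix} A&B\\ C&D\end{pmatrix}$ whose four $2\times2$ blocks have the form $\begin{pmatrix} z & -\overline w \\ w & \overline z \end{pmatrix}$, $z,w\in\mathbb C$; it acts on $\mathrm{Gr}_2(\mathbb C^4)$ in the natural way. For $f\in\mathrm{SR}(\Omega,\mathbb H)$, an element $T\in\mathrm{GL}(2,\mathbb H)$ is called $f$-admissible if $T\cdot G_f(V)\subset\mathcal U_6$, equivalently $\det(A+B\Phi_f(v))\neq0$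 for all $v\in V$. For $f$-admissible $T$, $T^*f$ denotes the unique function in $\mathrm{SR}(\Omega,\mathbb H)$ such that $G_{T^*f}=T\cdot G_f$; its graph matrix is $\Phi_{T^*f}(v)=(C+D\Phi_f(v))(A+B\Phi_f(v))^{-1}$ for $v\in V$.
   Formalization: "Well-defined" here requires that T be f-admissible and also that a slice-regular function with twistor curve T·G_f exist; admissibility on V alone does not give this (f(q)=q on the unit ball, T the block swap would force q⁻¹). *)

theory Defs
  imports "HOL-Analysis.Analysis" "HOL-Library.FuncSet" "HOL-Library.Numeral_Type"
begin

section \<open>Quaternions\<close>

datatype quat = Quat (qre: real) (qi: real) (qj: real) (qk: real)

lemma quat_eqI:
  "qre x = qre y \<Longrightarrow> qi x = qi y \<Longrightarrow> qj x = qj y \<Longrightarrow> qk x = qk y \<Longrightarrow> x = y"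
  by (simp add: quat.expand)

lemma quat_eq_iff:
  "x = y \<longleftrightarrow> qre x = qre y \<and> qi x = qi y \<and> qj x = qj y \<and> qk x = qk y"
  using quat_eqI by blast

instantiation quat :: ring_1
begin

definition "0 = Quat 0 0 0 0"
definition "1 = Quat 1 0 0 0"
definition "x + y = Quat (qre x + qre y) (qi x + qi y) (qj x + qj y) (qk x + qk y)"
definition "- x = Quat (- qre x) (- qi x) (- qj x) (- qk x)"
definition "x - y = Quat (qre x - qre y) (qi x - qi y) (qj x - qj y) (qk x - qk y)"
definition "x * y = Quat
  (qre x * qre y - qi x * qi y - qj x * qj y - qk x * qk y)
  (qre x * qi y + qi x * qre y + qj x * qk y - qk x * qj y)
  (qre x * qj y - qi x * qk y + qj x * qre y + qk x * qi y)
  (qre x * qk y + qi x * qj y - qj x * qi y + qk x * qre y)"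

instance
  by standard
     (simp_all add: zero_quat_def one_quat_def plus_quat_def uminus_quat_def minus_quat_def
        times_quat_def algebra_simps)

end

instantiation quat :: real_algebra_1
begin

definition "scaleR r x = Quat (r * qre x) (r * qi x) (r * qj x) (r * qk x)"

instance
  by standard
     (simp_all add: scaleR_quat_def plus_quat_def times_quat_def one_quat_def algebra_simps)

end

lemma quat_sel_simps [simp]:
  "qre 0 = 0" "qi 0 = 0" "qj 0 = 0" "qk 0 = 0"
  "qre 1 = 1" "qi 1 = 0" "qj 1 = 0" "qk 1 = 0"
  "qre (x + y) = qre x + qre y" "qi (x + y) = qi x + qi y"
  "qj (x + y) = qj x + qj y" "qk (x + y) = qk x + qk y"
  "qre (- x) = - qre x" "qi (- x) = - qi x" "qj (- x) = - qj x" "qk (- x) = - qk x"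
  "qre (x - y) = qre x - qre y" "qi (x - y) = qi x - qi y"
  "qj (x - y) = qj x - qj y" "qk (x - y) = qk x - qk y"
  "qre (r *\<^sub>R x) = r * qre x" "qi (r *\<^sub>R x) = r * qi x"
  "qj (r *\<^sub>R x) = r * qj x" "qk (r *\<^sub>R x) = r * qk x"
  "qre (of_real r) = r" "qi (of_real r) = 0" "qj (of_real r) = 0" "qk (of_real r) = 0"
  by (simp_all add: zero_quat_def one_quat_def plus_quat_def uminus_quat_def minus_quat_def
        scaleR_quat_def of_real_def)

lemma quat_times_sel:
  "qre (x * y) = qre x * qre y - qi x * qi y - qj x * qj y - qk x * qk y"
  "qi (x * y) = qre x * qi y + qi x * qre y + qj x * qk y - qk x * qj y"
  "qj (x * y) = qre x * qj y - qi x * qk y + qj x * qre y + qk x * qi y"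
  "qk (x * y) = qre x * qk y + qi x * qj y - qj x * qi y + qk x * qre y"
  by (simp_all add: times_quat_def)

instantiation quat :: real_inner
begin

definition inner_quat_def:
  "inner x y = qre x * qre y + qi x * qi y + qj x * qj y + qk x * qk y"
definition norm_quat_def: "norm (x::quat) = sqrt (inner x x)"
definition dist_quat_def: "dist x (y::quat) = norm (x - y)"
definition sgn_quat_def: "sgn (x::quat) = x /\<^sub>R norm x"
definition uniformity_quat_def [code del]:
  "(uniformity :: (quat \<times> quat) filter) = (INF e\<in>{0<..}. principal {(x, y). dist x y < e})"
definition open_quat_def [code del]:
  "open (U :: quat set) \<longleftrightarrow> (\<forall>x\<in>U. eventually (\<lambda>(x', y). x' = x \<longrightarrow> y \<in> U) uniformity)"

instance
proof
  fix x y z :: quat and r :: real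
  show "dist x y = norm (x - y)" by (rule dist_quat_def)
  show "sgn x = x /\<^sub>R norm x" by (rule sgn_quat_def)
  show "(uniformity :: (quat \<times> quat) filter) = (INF e\<in>{0<..}. principal {(x, y). dist x y < e})"
    by (rule uniformity_quat_def)
  show "open U \<longleftrightarrow> (\<forall>x\<in>U. eventually (\<lambda>(x', y). x' = x \<longrightarrow> y \<in> U) uniformity)"
    for U :: "quat set" by (rule open_quat_def)
  show "inner x y = inner y x" by (simp add: inner_quat_def mult.commute)
  show "inner (x + y) z = inner x z + inner y z" by (simp add: inner_quat_def algebra_simps)
  show "inner (r *\<^sub>R x) y = r * inner x y" by (simp add: inner_quat_def algebra_simps)
  show nn: "0 \<le> inner x x" by (simp add: inner_quat_def)
  show "inner x x = 0 \<longleftrightarrow> x = 0"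
  proof
    assume "inner x x = 0"
    then have "(qre x)\<^sup>2 + (qi x)\<^sup>2 + (qj x)\<^sup>2 + (qk x)\<^sup>2 = 0"
      by (simp add: inner_quat_def power2_eq_square)
    moreover have "(qre x)\<^sup>2 \<ge> 0" "(qi x)\<^sup>2 \<ge> 0" "(qj x)\<^sup>2 \<ge> 0" "(qk x)\<^sup>2 \<ge> 0" by simp_all
    ultimately have "(qre x)\<^sup>2 = 0 \<and> (qi x)\<^sup>2 = 0 \<and> (qj x)\<^sup>2 = 0 \<and> (qk x)\<^sup>2 = 0" by linarith
    then show "x = 0" by (simp add: quat_eq_iff)
  qed (simp add: inner_quat_def)
  show "norm x = sqrt (inner x x)" by (rule norm_quat_def)
qed

end

instantiation quat :: real_normed_div_algebra
begin

definition inverse_quat_def: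
  "inverse x = inverse (inner x x) *\<^sub>R Quat (qre x) (- qi x) (- qj x) (- qk x)"
definition divide_quat_def: "x div (y::quat) = x * inverse y"

instance
proof
  fix x y :: quat
  have conj: "x * Quat (qre x) (- qi x) (- qj x) (- qk x) = of_real (inner x x)"
       "Quat (qre x) (- qi x) (- qj x) (- qk x) * x = of_real (inner x x)"
    by (simp_all add: quat_eq_iff quat_times_sel inner_quat_def algebra_simps)
  show "inverse x * x = 1" "x * inverse x = 1" if "x \<noteq> 0"
    using that inner_eq_zero_iff[of x]
    by (simp_all add: inverse_quat_def conj of_real_def)
  show "x div y = x * inverse y" by (rule divide_quat_def)
  show "inverse (0::quat) = 0" by (simp add: inverse_quat_def)
  have "inner (x * y) (x * y) = inner x x * inner y y"
    by (simp add: inner_quat_def quat_times_sel algebra_simps)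
  then show "norm (x * y) = norm x * norm y"
    by (simp add: norm_quat_def real_sqrt_mult)
qed

end

definition imag_units :: "quat set" where
  "imag_units = {q. q\<^sup>2 = -1}"


section \<open>Symmetric slice domains and slice regular functions\<close>

text \<open>The point $x + yI$, with the pair $(x,y)$ encoded as the complex number $z$.
  For a fixed unit $I$ this identifies \<^typ>\<open>complex\<close> with $\mathbb R + \mathbb R I$;
  functions on $\Omega_I$ are written as functions of that complex variable.\<close>

definition slice_pt :: "quat \<Rightarrow> complex \<Rightarrow> quat" where
  "slice_pt I z = of_real (Re z) + of_real (Im z) * I"

definition slice_plane :: "quat \<Rightarrow> quat set" where
  "slice_plane I = range (slice_pt I)"

definition symmetric_slice_domain :: "quat set \<Rightarrow> bool" where
  "symmetric_slice_domain \<Omega> \<longleftrightarrow>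
     open \<Omega> \<and> connected \<Omega> \<and> \<Omega> \<inter> \<real> \<noteq> {} \<and>
     (\<forall>I\<in>imag_units. openin (top_of_set (slice_plane I)) (\<Omega> \<inter> slice_plane I) \<and>
                     connected (\<Omega> \<inter> slice_plane I)) \<and>
     (\<forall>x y. \<forall>I\<in>imag_units. \<forall>I'\<in>imag_units.
        of_real x + of_real y * I \<in> \<Omega> \<longrightarrow> of_real x + of_real y * I' \<in> \<Omega>)"

text \<open>Holomorphy is real differentiability of $(x,y) \mapsto f(x+yI)$ together with the
  Cauchy-Riemann equation; \<open>D 1\<close> and \<open>D \<i>\<close> are the partial derivatives $\partial_x$, $\partial_y$.\<close>

definition slice_regular_on :: "(quat \<Rightarrow> quat) \<Rightarrow> quat set \<Rightarrow> bool" where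
  "slice_regular_on f \<Omega> \<longleftrightarrow>
     (\<forall>I\<in>imag_units. \<forall>z. slice_pt I z \<in> \<Omega> \<longrightarrow>
        (\<exists>D. ((\<lambda>w. f (slice_pt I w)) has_derivative D) (at z) \<and>
             (1/2) *\<^sub>R (D 1 + I * D \<i>) = 0))"

text \<open>Functions on $\Omega$ are represented by their extensional representatives, so that
  equality of functions $\Omega \to \mathbb H$ is equality in HOL.\<close>

definition SR :: "quat set \<Rightarrow> (quat \<Rightarrow> quat) set" where
  "SR \<Omega> = {f \<in> extensional \<Omega>. slice_regular_on f \<Omega>}"


section \<open>The twistor transform\<close>

text \<open>Coordinates $(a,b)$ of $q = a + bj$ with $a, b \in \mathbb R + \mathbb R i$, for
  anticommuting units $i$, $j$.\<close>

definition cpair :: "quat \<Rightarrow> quat \<Rightarrow> quat \<Rightarrow> complex \<times> complex" where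
  "cpair i j q = (THE p. q = slice_pt i (fst p) + slice_pt i (snd p) * j)"

definition split_g :: "quat \<Rightarrow> quat \<Rightarrow> (quat \<Rightarrow> quat) \<Rightarrow> complex \<Rightarrow> complex" where
  "split_g i j f z = fst (cpair i j (f (slice_pt i z)))"

definition split_h :: "quat \<Rightarrow> quat \<Rightarrow> (quat \<Rightarrow> quat) \<Rightarrow> complex \<Rightarrow> complex" where
  "split_h i j f z = snd (cpair i j (f (slice_pt i z)))"

definition hat :: "(complex \<Rightarrow> complex) \<Rightarrow> complex \<Rightarrow> complex" where
  "hat u z = cnj (u (cnj z))"

definition upper_part :: "quat \<Rightarrow> quat set \<Rightarrow> complex set" where
  "upper_part i \<Omega> = {z. Im z > 0 \<and> slice_pt i z \<in> \<Omega>}"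

definition graph_matrix :: "quat \<Rightarrow> quat \<Rightarrow> (quat \<Rightarrow> quat) \<Rightarrow> complex \<Rightarrow> complex^2^2" where
  "graph_matrix i j f z =
     vector [vector [split_g i j f z, - hat (split_h i j f) z],
             vector [split_h i j f z,   hat (split_g i j f) z]]"

text \<open>$\mathbb C^4 = \mathbb C^2 \oplus \mathbb C^2$ is \<^typ>\<open>complex^(2+2)\<close>; the two halves of the
  index type are the images of \<^const>\<open>Inl\<close> and \<^const>\<open>Inr\<close>.\<close>

type_synonym C4 = "complex^(2+2)"

definition vec_join :: "complex^2 \<Rightarrow> complex^2 \<Rightarrow> C4" where
  "vec_join x y = (\<chi> k. case k of Inl a \<Rightarrow> x $ a | Inr b \<Rightarrow> y $ b)"

definition Gr2 :: "C4 set set" where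
  "Gr2 = {W. vec.subspace W \<and> vec.dim W = 2}"

definition graph_plane :: "complex^2^2 \<Rightarrow> C4 set" where
  "graph_plane \<Phi> = {vec_join x (\<Phi> *v x) | x. True}"

definition U6 :: "C4 set set" where
  "U6 = {graph_plane \<Phi> | \<Phi>. True}"

definition twistor :: "quat \<Rightarrow> quat \<Rightarrow> (quat \<Rightarrow> quat) \<Rightarrow> complex \<Rightarrow> C4 set" where
  "twistor i j f v = graph_plane (graph_matrix i j f v)"

definition quat_block :: "complex^2^2 \<Rightarrow> bool" where
  "quat_block M \<longleftrightarrow> (\<exists>z w. M = vector [vector [z, - cnj w], vector [w, cnj z]])"

definition GL2H :: "(complex^(2+2)^(2+2)) set" where
  "GL2H = {T. invertible T \<and>
      quat_block (\<chi> a b. T $ Inl a $ Inl b) \<and> quat_block (\<chi> a b. T $ Inl a $ Inr b) \<and>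
      quat_block (\<chi> a b. T $ Inr a $ Inl b) \<and> quat_block (\<chi> a b. T $ Inr a $ Inr b)}"

definition act :: "complex^(2+2)^(2+2) \<Rightarrow> C4 set \<Rightarrow> C4 set" where
  "act T W = (\<lambda>x. T *v x) ` W"

definition admissible ::
  "quat \<Rightarrow> quat \<Rightarrow> quat set \<Rightarrow> complex^(2+2)^(2+2) \<Rightarrow> (quat \<Rightarrow> quat) \<Rightarrow> bool" where
  "admissible i j \<Omega> T f \<longleftrightarrow> (\<forall>v\<in>upper_part i \<Omega>. act T (twistor i j f v) \<in> U6)"

definition is_star ::
  "quat \<Rightarrow> quat \<Rightarrow> quat set \<Rightarrow> complex^(2+2)^(2+2) \<Rightarrow> (quat \<Rightarrow> quat) \<Rightarrow> (quat \<Rightarrow> quat) \<Rightarrow> bool" where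
  "is_star i j \<Omega> T f F \<longleftrightarrow>
     F \<in> SR \<Omega> \<and> (\<forall>v\<in>upper_part i \<Omega>. twistor i j F v = act T (twistor i j f v))"

definition star ::
  "quat \<Rightarrow> quat \<Rightarrow> quat set \<Rightarrow> complex^(2+2)^(2+2) \<Rightarrow> (quat \<Rightarrow> quat) \<Rightarrow> (quat \<Rightarrow> quat)" where
  "star i j \<Omega> T f = (THE F. is_star i j \<Omega> T f F)"

text \<open>Admissibility constrains $T$ only on the open upper half $V$ and does not by itself give a
  regular function across $\Omega \cap \mathbb R$: for $f(q) = q$ on the unit ball and $T$ the
  exchange of the two summands, $T$ is $f$-admissible, but off the reals $T^*f$ would have to be
  $q^{-1}$. The existence of $T^*f$ is therefore part of its being well-defined.\<close>

definition star_defined ::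
  "quat \<Rightarrow> quat \<Rightarrow> quat set \<Rightarrow> complex^(2+2)^(2+2) \<Rightarrow> (quat \<Rightarrow> quat) \<Rightarrow> bool" where
  "star_defined i j \<Omega> T f \<longleftrightarrow>
     f \<in> SR \<Omega> \<and> T \<in> GL2H \<and> admissible i j \<Omega> T f \<and> (\<exists>F. is_star i j \<Omega> T f F)"


section \<open>Consistency of the definitions\<close>

lemma imag_units_iff:
  "q \<in> imag_units \<longleftrightarrow> qre q = 0 \<and> (qi q)\<^sup>2 + (qj q)\<^sup>2 + (qk q)\<^sup>2 = 1"
proof
  assume "q \<in> imag_units"
  then have eq: "q * q = -1" by (simp add: imag_units_def power2_eq_square)
  then have e: "qre q * qre q - qi q * qi q - qj q * qj q - qk q * qk q = -1"
     "qre q * qi q = 0" "qre q * qj q = 0" "qre q * qk q = 0"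
    by (auto simp: quat_eq_iff quat_times_sel)
  have "qre q = 0"
  proof (rule ccontr)
    assume "qre q \<noteq> 0"
    with e have "qre q * qre q = -1" by simp
    then show False using zero_le_square[of "qre q"] by linarith
  qed
  with e show "qre q = 0 \<and> (qi q)\<^sup>2 + (qj q)\<^sup>2 + (qk q)\<^sup>2 = 1"
    by (simp add: power2_eq_square)
next
  assume "qre q = 0 \<and> (qi q)\<^sup>2 + (qj q)\<^sup>2 + (qk q)\<^sup>2 = 1"
  then show "q \<in> imag_units"
    by (simp add: imag_units_def power2_eq_square quat_eq_iff quat_times_sel)
qed

lemma slice_plane_if_commute:
  assumes i: "i \<in> imag_units" and c: "i * q = q * i"
  shows "q \<in> slice_plane i"
proof -
  define t where "t = qi i * qi q + qj i * qj q + qk i * qk q"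
  have u: "qre i = 0" "qi i * qi i + qj i * qj i + qk i * qk i = 1"
    using i by (simp_all add: imag_units_iff power2_eq_square)
  from c have c': "qj i * qk q = qk i * qj q" "qk i * qi q = qi i * qk q" "qi i * qj q = qj i * qi q"
    by (auto simp: quat_eq_iff quat_times_sel u algebra_simps)
  have "qi q = t * qi i"
  proof -
    have "t * qi i = qi i * qi i * qi q + qj i * (qi i * qj q) + qk i * (qi i * qk q)"
      by (simp add: t_def algebra_simps)
    also have "\<dots> = (qi i * qi i + qj i * qj i + qk i * qk i) * qi q"
      by (simp add: c' flip: c'(2)) (simp add: algebra_simps)
    finally show ?thesis by (simp add: u)
  qed
  moreover have "qj q = t * qj i"
  proof -
    have "t * qj i = qi i * (qj i * qi q) + qj i * qj i * qj q + qk i * (qj i * qk q)"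
      by (simp add: t_def algebra_simps)
    also have "\<dots> = (qi i * qi i + qj i * qj i + qk i * qk i) * qj q"
      by (simp add: c'(1) flip: c'(3)) (simp add: algebra_simps)
    finally show ?thesis by (simp add: u)
  qed
  moreover have "qk q = t * qk i"
  proof -
    have "t * qk i = qi i * (qk i * qi q) + qj i * (qk i * qj q) + qk i * qk i * qk q"
      by (simp add: t_def algebra_simps)
    also have "\<dots> = (qi i * qi i + qj i * qj i + qk i * qk i) * qk q"
      by (simp add: c'(2) flip: c'(1)) (simp add: algebra_simps)
    finally show ?thesis by (simp add: u)
  qed
  ultimately have "q = slice_pt i (Complex (qre q) t)"
    by (simp add: slice_pt_def quat_eq_iff quat_times_sel u)
  then show ?thesis unfolding slice_plane_def by blast
qed

lemma slice_pt_commute: "slice_pt i z * i = i * slice_pt i z"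
  by (simp add: slice_pt_def algebra_simps of_real_def)

lemma slice_pt_eq_0: "i \<in> imag_units \<Longrightarrow> slice_pt i z = 0 \<Longrightarrow> z = 0"
proof -
  assume i: "i \<in> imag_units" and z: "slice_pt i z = 0"
  have u: "qre i = 0" "(qi i)\<^sup>2 + (qj i)\<^sup>2 + (qk i)\<^sup>2 = 1" using i by (simp_all add: imag_units_iff)
  from z have e: "Re z = 0" "Im z * qi i = 0" "Im z * qj i = 0" "Im z * qk i = 0"
    by (simp_all add: slice_pt_def quat_eq_iff quat_times_sel u)
  have "Im z = 0" using e u by (cases "Im z = 0") auto
  with e show ?thesis by (simp add: complex_eq_iff)
qed

lemma cpair_ex1:
  assumes i: "i \<in> imag_units" and j: "j \<in> imag_units" and ij: "i * j = - (j * i)"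
  shows "\<exists>!p. q = slice_pt i (fst p) + slice_pt i (snd p) * j"
proof -
  have ii: "i * i = -1" "j * j = -1" using i j by (simp_all add: imag_units_def power2_eq_square)
  have ii': "i * (i * x) = - x" "j * (j * x) = - x" for x
    using ii by (simp_all flip: mult.assoc)
  have ij': "i * (j * x) = - (j * (i * x))" for x using ij by (simp flip: mult.assoc)
  define a where "a = (1/2) *\<^sub>R (q - i * q * i)"
  define b where "b = - ((1/2) *\<^sub>R (q + i * q * i) * j)"
  have "i * a = a * i" "i * b = b * i"
    by (simp_all add: a_def b_def algebra_simps ii ii' ij)
  then obtain z w where zw: "a = slice_pt i z" "b = slice_pt i w"
    using slice_plane_if_commute[OF i] unfolding slice_plane_def by (metis rangeE)
  have "a + b * j = (1/2) *\<^sub>R (q + q)"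
    by (simp add: a_def b_def mult.assoc ii algebra_simps)
  then have "q = a + b * j" by (simp flip: scaleR_2)
  moreover have "p = p'"
    if p: "q = slice_pt i (fst p) + slice_pt i (snd p) * j"
      and p': "q = slice_pt i (fst p') + slice_pt i (snd p') * j" for p p'
  proof -
    define c where "c = slice_pt i (fst p - fst p')"
    define d where "d = slice_pt i (snd p - snd p')"
    have c: "c + d * j = 0"
      using p p' by (simp add: c_def d_def slice_pt_def algebra_simps)
    have com: "c * i = i * c" "d * i = i * d" by (simp_all add: c_def d_def slice_pt_commute)
    have "0 = i * (c + d * j) - (c + d * j) * i" by (simp add: c)
    also have "\<dots> = i * (d * j) - d * (j * i)" by (simp add: algebra_simps com)
    also have "d * (j * i) = - (d * (i * j))" by (simp add: ij)
    also have "\<dots> = - (i * (d * j))" by (simp add: com flip: mult.assoc)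
    finally have "(2::real) *\<^sub>R (i * (d * j)) = 0" by (simp add: scaleR_2)
    moreover have "i \<noteq> 0" "j \<noteq> 0" using ii by auto
    ultimately have "d = 0" by simp
    with c have "c = 0" by simp
    from \<open>c = 0\<close> \<open>d = 0\<close> have "fst p - fst p' = 0" "snd p - snd p' = 0"
      unfolding c_def d_def using slice_pt_eq_0[OF i] by blast+
    then show ?thesis by (simp add: prod_eq_iff)
  qed
  ultimately show ?thesis using zw by (intro ex1I[of _ "(z, w)"]) auto
qed

lemma U6_subset_Gr2: "U6 \<subseteq> Gr2"
proof -
  have "graph_plane \<Phi> \<in> Gr2" for \<Phi>
  proof -
    let ?l = "\<lambda>x. vec_join x (\<Phi> *v x)"
    have lin: "Vector_Spaces.linear (*s) (*s) ?l"
      by (auto simp: Vector_Spaces.linear_iff vec.vector_space_axioms vec_join_def vec_eq_iff matrix_vector_right_distrib vec.scale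
            split: sum.splits)
    have inj: "inj ?l" by (auto simp: inj_on_def vec_join_def vec_eq_iff split: sum.splits)
    have img: "graph_plane \<Phi> = range ?l" by (auto simp: graph_plane_def)
    have "vec.dim (range ?l) = vec.dim (UNIV :: (complex^2) set)"
      using inj by (intro vec.dim_image_eq[OF lin]) (auto simp: inj_on_def)
    then show ?thesis
      using vec.linear_subspace_image[OF lin vec.subspace_UNIV]
      by (simp add: Gr2_def img card_cart_basis)
  qed
  then show ?thesis by (auto simp: U6_def)
qed

end

theory Submission
  imports Defs "HOL-Complex_Analysis.Conformal_Mappings"
begin

text \<open>
  Both \<open>(S ** T)\<^sup>* f\<close> and \<open>S\<^sup>* (T\<^sup>* f)\<close> have the twistor curve \<open>v \<mapsto> S T \<cdot> G\<^sub>f(v)\<close>, because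
  matrices act on subspaces compatibly with products; likewise \<open>f\<close> itself has the curve
  \<open>1 \<cdot> G\<^sub>f\<close>. So everything rests on one fact: a slice regular function on a symmetric slice
  domain is determined by its twistor transform (\<open>SR_eq_if_twistor_eq\<close>).

  A graph determines its matrix, and the first column of that matrix holds the coordinates of
  \<open>f\<close>, so equal twistor transforms give functions that agree on the upper half of the slice
  \<open>\<Omega>\<^sub>i\<close>. By continuity they agree on \<open>\<Omega> \<inter> \<real>\<close>. Real points belong to all slices
  simultaneously, and an identity principle on each connected \<open>\<Omega>\<^sub>I\<close>
  (\<open>slice_regular_zero_if_zero_on_reals\<close>) spreads the agreement over all of \<open>\<Omega>\<close>. The latter
  reduces to the identity theorem for scalar holomorphic functions by pairing the quaternionic
  values with a fixed quaternion, through the form that is complex linear for left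
  multiplication by \<open>I\<close>.
\<close>

section \<open>Slices and their coordinates\<close>

lemma inner_imag_unit_self: "I \<in> imag_units \<Longrightarrow> inner I I = 1"
  by (simp add: imag_units_iff inner_quat_def power2_eq_square)

lemma imag_unit_square: "I \<in> imag_units \<Longrightarrow> I * I = -1"
  by (simp add: imag_units_def power2_eq_square)

lemma slice_pt_of_real [simp]: "slice_pt I (of_real r) = of_real r"
  by (simp add: slice_pt_def)

lemma continuous_on_slice_pt: "continuous_on A (slice_pt I)"
  unfolding slice_pt_def by (intro continuous_intros)

lemma slice_coords:
  assumes "I \<in> imag_units"
  shows "Complex (inner (slice_pt I z) 1) (inner (slice_pt I z) I) = z"
proof -
  have "inner 1 I = 0" using assms by (simp add: imag_units_iff inner_quat_def)
  moreover have "inner (1::quat) 1 = 1" by (simp add: inner_quat_def)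
  ultimately show ?thesis
    using inner_imag_unit_self[OF assms]
    by (simp add: slice_pt_def of_real_def inner_add_left complex_eq_iff inner_commute[of I 1])
qed

lemma ex_slice_pt:
  assumes i: "i \<in> imag_units"
  shows "\<exists>I\<in>imag_units. \<exists>z. q = slice_pt I z"
proof (cases "qi q = 0 \<and> qj q = 0 \<and> qk q = 0")
  case True
  then have "q = slice_pt i (of_real (qre q))" by (simp add: quat_eq_iff)
  with i show ?thesis by blast
next
  case False
  define s where "s = (qi q)\<^sup>2 + (qj q)\<^sup>2 + (qk q)\<^sup>2"
  define y where "y = sqrt s"
  have "s > 0"
    using False unfolding s_def
    by (metis add_nonneg_eq_0_iff add_nonneg_nonneg less_eq_real_def power_eq_0_iff zero_le_power2)
  then have y: "y > 0" "y\<^sup>2 = s" by (auto simp: y_def)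
  define I where "I = Quat 0 (qi q / y) (qj q / y) (qk q / y)"
  have "(qi q)\<^sup>2 / y\<^sup>2 + (qj q)\<^sup>2 / y\<^sup>2 + (qk q)\<^sup>2 / y\<^sup>2 = s / y\<^sup>2"
    by (simp add: s_def add_divide_distrib)
  then have "I \<in> imag_units"
    using y \<open>s > 0\<close> by (simp add: imag_units_iff I_def power_divide)
  moreover have "q = slice_pt I (Complex (qre q) y)"
    using y by (simp add: slice_pt_def I_def quat_eq_iff quat_times_sel)
  ultimately show ?thesis by blast
qed

definition slice_region :: "quat \<Rightarrow> quat set \<Rightarrow> complex set" where
  "slice_region I \<Omega> = {z. slice_pt I z \<in> \<Omega>}"

lemma open_slice_region: "open \<Omega> \<Longrightarrow> open (slice_region I \<Omega>)"
  using continuous_on_slice_pt[of UNIV I]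
  by (simp add: slice_region_def continuous_on_open_vimage vimage_def)

text \<open>The inner products with \<open>1\<close> and \<open>I\<close> give a continuous inverse of \<open>slice_pt I\<close>.\<close>

lemma connected_slice_region:
  assumes I: "I \<in> imag_units" and con: "connected (\<Omega> \<inter> slice_plane I)"
  shows "connected (slice_region I \<Omega>)"
proof -
  let ?c = "\<lambda>q. Complex (inner q 1) (inner q I)"
  have "\<Omega> \<inter> slice_plane I = slice_pt I ` slice_region I \<Omega>"
    by (auto simp: slice_region_def slice_plane_def)
  then have "slice_region I \<Omega> = ?c ` (\<Omega> \<inter> slice_plane I)"
    by (simp add: image_image slice_coords[OF I])
  moreover have "continuous_on (\<Omega> \<inter> slice_plane I) ?c"
    unfolding Complex_eq by (intro continuous_intros)
  ultimately show ?thesis using connected_continuous_image[OF _ con] by metis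
qed

section \<open>The identity principle from the real points\<close>

text \<open>
  For every \<open>u\<close> the map \<open>q \<mapsto> slice_form I u q\<close> turns left multiplication by \<open>I\<close> into
  multiplication by \<open>\<i>\<close>. It plays the part of the coordinates of \<open>q = a + b J\<close>, without
  a choice of \<open>J\<close>, and for \<open>u = q\<close> its real part is the squared norm of \<open>q\<close>.
\<close>

definition slice_form :: "quat \<Rightarrow> quat \<Rightarrow> quat \<Rightarrow> complex" where
  "slice_form I u q = of_real (inner q u) + \<i> * of_real (inner q (I * u))"

lemma bounded_linear_slice_form: "bounded_linear (slice_form I u)"
  unfolding slice_form_def
  by (intro bounded_linear_add bounded_linear_const_mult bounded_linear_compose[OF bounded_linear_of_real]
        bounded_linear_inner_left)

text \<open>Left multiplication by an imaginary unit is an isometry with square \<open>-1\<close>, hence skew-adjoint.\<close>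

lemma slice_form_mult_unit:
  assumes I: "I \<in> imag_units"
  shows "slice_form I u (I * q) = \<i> * slice_form I u q"
proof -
  have re: "qre I = 0" using I by (simp add: imag_units_iff)
  have skew: "inner (I * q) v = - inner q (I * v)" for v
    by (simp add: inner_quat_def quat_times_sel re algebra_simps)
  have "I * (I * u) = - u"
    using imag_unit_square[OF I] by (simp flip: mult.assoc)
  then have "inner (I * q) (I * u) = inner q u" by (simp add: skew)
  then show ?thesis by (simp add: slice_form_def skew complex_eq_iff)
qed

text \<open>
  The Cauchy-Riemann equation says that the real differential intertwines \<open>\<i>\<close> with left
  multiplication by \<open>I\<close>, which the form turns back into \<open>\<i>\<close>.
\<close>

lemma slice_form_holomorphic:
  assumes I: "I \<in> imag_units" and f: "slice_regular_on f \<Omega>"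
  shows "(\<lambda>w. slice_form I u (f (slice_pt I w))) holomorphic_on slice_region I \<Omega>"
proof (rule holomorphic_onI)
  fix z assume "z \<in> slice_region I \<Omega>"
  then obtain D where D: "((\<lambda>w. f (slice_pt I w)) has_derivative D) (at z)"
    and CR: "(1/2) *\<^sub>R (D 1 + I * D \<i>) = 0"
    using I f unfolding slice_regular_on_def slice_region_def by blast
  let ?L = "slice_form I u"
  interpret L: bounded_linear ?L by (rule bounded_linear_slice_form)
  interpret D: bounded_linear D using D by (rule has_derivative_bounded_linear)
  have "I * (D 1 + I * D \<i>) = 0" using CR by simp
  then have "I * D 1 + (I * I) * D \<i> = 0" by (simp add: distrib_left mult.assoc)
  then have Di: "D \<i> = I * D 1" by (simp add: imag_unit_square[OF I])
  have "(\<lambda>w. ?L (D w)) = (*) (?L (D 1))"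
  proof
    fix w
    have "w = Re w *\<^sub>R 1 + Im w *\<^sub>R \<i>" by (simp add: complex_eq_iff)
    then have "D w = Re w *\<^sub>R D 1 + Im w *\<^sub>R (I * D 1)"
      by (metis D.add D.scaleR Di)
    then have "?L (D w) = ?L (D 1) * (Re w *\<^sub>R 1 + Im w *\<^sub>R \<i>)"
      by (simp only: L.add L.scaleR slice_form_mult_unit[OF I]) (simp add: algebra_simps)
    also have "\<dots> = ?L (D 1) * w" by (simp add: complex_eq_iff)
    finally show "?L (D w) = ?L (D 1) * w" .
  qed
  then have "((\<lambda>w. ?L (f (slice_pt I w))) has_field_derivative ?L (D 1)) (at z)"
    using L.has_derivative[OF D] unfolding has_field_derivative_def by argo
  then show "(\<lambda>w. ?L (f (slice_pt I w))) field_differentiable at z within slice_region I \<Omega>"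
    using field_differentiable_at_within field_differentiable_def by blast
qed

text \<open>
  On a slice, the real points of an open set accumulate at each of them, so each holomorphic
  function obtained from the form vanishes on the whole connected slice.
\<close>

lemma slice_regular_zero_if_zero_on_reals:
  assumes \<Omega>: "symmetric_slice_domain \<Omega>" and i: "i \<in> imag_units"
    and f: "slice_regular_on f \<Omega>"
    and zero: "\<And>r. of_real r \<in> \<Omega> \<Longrightarrow> f (of_real r) = 0"
    and q: "q \<in> \<Omega>"
  shows "f q = 0"
proof -
  obtain I z where I: "I \<in> imag_units" and qz: "q = slice_pt I z"
    using ex_slice_pt[OF i] by blast
  let ?S = "slice_region I \<Omega>"
  let ?F = "\<lambda>w. slice_form I (f q) (f (slice_pt I w))"
  have op: "open ?S" and con: "connected ?S"
    using \<Omega> I by (auto simp: symmetric_slice_domain_def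
                     intro: open_slice_region connected_slice_region)
  obtain r where r: "of_real r \<in> \<Omega>"
    using \<Omega> by (auto simp: symmetric_slice_domain_def Reals_def)
  then have rS: "of_real r \<in> ?S" by (simp add: slice_region_def)
  have lim: "(of_real r :: complex) islimpt ?S \<inter> \<real>"
  proof -
    have "(r::real) islimpt UNIV" by simp
    then have "(of_real r :: complex) islimpt \<real>"
      unfolding islimpt_approachable Reals_def
      by (metis dist_of_real of_real_eq_iff rangeI)
    then show ?thesis
      using islimpt_Int_eventually eventually_at_in_open'[OF op rS] by (metis Int_commute)
  qed
  have "?F z = 0"
  proof (rule analytic_continuation[OF slice_form_holomorphic[OF I f] op con _ rS lim])
    show "?F w = 0" if "w \<in> ?S \<inter> \<real>" for w
      using that zero by (auto simp: Reals_def slice_region_def slice_form_def)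
    show "z \<in> ?S" using q qz by (simp add: slice_region_def)
  qed auto
  then have "Re (slice_form I (f q) (f q)) = 0" by (simp add: qz)
  then show ?thesis by (simp add: slice_form_def)
qed

lemma slice_regular_on_diff:
  assumes "slice_regular_on f \<Omega>" "slice_regular_on g \<Omega>"
  shows "slice_regular_on (\<lambda>q. f q - g q) \<Omega>"
  unfolding slice_regular_on_def
proof (intro ballI allI impI)
  fix I z assume "I \<in> imag_units" "slice_pt I z \<in> \<Omega>"
  with assms obtain D E where
    D: "((\<lambda>w. f (slice_pt I w)) has_derivative D) (at z)" "(1/2) *\<^sub>R (D 1 + I * D \<i>) = 0" and
    E: "((\<lambda>w. g (slice_pt I w)) has_derivative E) (at z)" "(1/2) *\<^sub>R (E 1 + I * E \<i>) = 0"
    unfolding slice_regular_on_def by meson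
  have "(D 1 - E 1) + I * (D \<i> - E \<i>) = (D 1 + I * D \<i>) - (E 1 + I * E \<i>)"
    by (simp add: algebra_simps)
  with D E have "(1/2) *\<^sub>R ((D 1 - E 1) + I * (D \<i> - E \<i>)) = 0" by simp
  with has_derivative_diff[OF D(1) E(1)]
  show "\<exists>D. ((\<lambda>w. f (slice_pt I w) - g (slice_pt I w)) has_derivative D) (at z) \<and>
            (1/2) *\<^sub>R (D 1 + I * D \<i>) = 0"
    by (intro exI[of _ "\<lambda>w. D w - E w"]) simp
qed

text \<open>
  The upper half of one slice is enough: every real point of \<open>\<Omega>\<close> is a limit of such points,
  and slice regular functions are continuous along each slice.
\<close>

lemma SR_eq_if_eq_on_upper_part:
  assumes \<Omega>: "symmetric_slice_domain \<Omega>" and i: "i \<in> imag_units"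
    and F: "F \<in> SR \<Omega>" and G: "G \<in> SR \<Omega>"
    and eq: "\<And>v. v \<in> upper_part i \<Omega> \<Longrightarrow> F (slice_pt i v) = G (slice_pt i v)"
  shows "F = G"
proof
  fix q
  let ?H = "\<lambda>q. F q - G q"
  have reg: "slice_regular_on ?H \<Omega>"
    using F G by (intro slice_regular_on_diff) (auto simp: SR_def)
  have op: "open (slice_region i \<Omega>)"
    using \<Omega> by (intro open_slice_region) (simp add: symmetric_slice_domain_def)
  show "F q = G q"
  proof (cases "q \<in> \<Omega>")
    case False
    with F G show ?thesis by (auto simp: SR_def extensional_def)
  next
    case True
    have "?H (of_real r) = 0" if r: "of_real r \<in> \<Omega>" for r
    proof -
      let ?h = "\<lambda>w. ?H (slice_pt i w)" and ?p = "\<lambda>t. Complex r t"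
      have rS: "complex_of_real r \<in> slice_region i \<Omega>" using r by (simp add: slice_region_def)
      have "slice_pt i (of_real r) \<in> \<Omega>" using r by simp
      then obtain D where "(?h has_derivative D) (at (of_real r))"
        using reg i unfolding slice_regular_on_def by meson
      then have cont: "isCont ?h (of_real r)" by (rule has_derivative_continuous)
      have "isCont ?p 0" unfolding Complex_eq by (intro continuous_intros)
      then have p: "(?p \<longlongrightarrow> of_real r) (at_right 0)"
        by (metis complex_of_real_def isCont_def filterlim_at_split)
      \<comment> \<open>Approach \<open>r\<close> vertically from the upper half plane.\<close>
      have "((\<lambda>t. ?h (?p t)) \<longlongrightarrow> ?h (of_real r)) (at_right 0)"
        using isCont_tendsto_compose[OF cont p] .
      moreover have "eventually (\<lambda>t. ?h (?p t) = 0) (at_right 0)"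
        using topological_tendstoD[OF p op rS] eventually_at_right_less[of "0::real"]
      proof eventually_elim
        case (elim t)
        then have "?p t \<in> upper_part i \<Omega>" by (simp add: upper_part_def slice_region_def)
        then show ?case using eq by simp
      qed
      then have "((\<lambda>t. ?h (?p t)) \<longlongrightarrow> 0) (at_right 0)" by (rule tendsto_eventually)
      ultimately have "?h (of_real r) = 0"
        using tendsto_unique trivial_limit_at_right_real by blast
      then show ?thesis by simp
    qed
    from slice_regular_zero_if_zero_on_reals[OF \<Omega> i reg this True] show ?thesis by simp
  qed
qed

section \<open>Slice regular functions are determined by their twistor transforms\<close>

lemma graph_plane_inject: "graph_plane \<Phi> = graph_plane \<Psi> \<longleftrightarrow> \<Phi> = \<Psi>"
proof
  assume eq: "graph_plane \<Phi> = graph_plane \<Psi>"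
  have "\<Phi> *v x = \<Psi> *v x" for x
  proof -
    have "vec_join x (\<Phi> *v x) \<in> graph_plane \<Psi>"
      unfolding eq[symmetric] unfolding graph_plane_def by blast
    then obtain y where y: "vec_join x (\<Phi> *v x) = vec_join y (\<Psi> *v y)"
      by (auto simp: graph_plane_def)
    have "x $ a = y $ a \<and> (\<Phi> *v x) $ a = (\<Psi> *v y) $ a" for a
      using arg_cong[OF y, of "\<lambda>v. v $ Inl a"] arg_cong[OF y, of "\<lambda>v. v $ Inr a"]
      by (simp add: vec_join_def)
    then have "x = y" "\<Phi> *v x = \<Psi> *v y" by (simp_all add: vec_eq_iff)
    then show ?thesis by simp
  qed
  then show "\<Phi> = \<Psi>" by (simp add: matrix_eq)
qed simp

lemma SR_eq_if_twistor_eq: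
  assumes i: "i \<in> imag_units" and j: "j \<in> imag_units" and ij: "i * j = - (j * i)"
    and \<Omega>: "symmetric_slice_domain \<Omega>" and "F \<in> SR \<Omega>" "G \<in> SR \<Omega>"
    and eq: "\<And>v. v \<in> upper_part i \<Omega> \<Longrightarrow> twistor i j F v = twistor i j G v"
  shows "F = G"
proof (rule SR_eq_if_eq_on_upper_part[OF \<Omega> i \<open>F \<in> SR \<Omega>\<close> \<open>G \<in> SR \<Omega>\<close>])
  fix v assume "v \<in> upper_part i \<Omega>"
  then have m: "graph_matrix i j F v = graph_matrix i j G v"
    using eq by (simp add: twistor_def graph_plane_inject)
  have "split_g i j F v = split_g i j G v" "split_h i j F v = split_h i j G v"
    using arg_cong[OF m, of "\<lambda>M. M $ 1 $ 1"] arg_cong[OF m, of "\<lambda>M. M $ 2 $ 1"]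
    by (simp_all add: graph_matrix_def)
  then have "cpair i j (F (slice_pt i v)) = cpair i j (G (slice_pt i v))"
    by (simp add: split_g_def split_h_def prod_eq_iff)
  moreover have "q = slice_pt i (fst (cpair i j q)) + slice_pt i (snd (cpair i j q)) * j" for q
    unfolding cpair_def by (rule theI'[OF cpair_ex1[OF i j ij]])
  ultimately show "F (slice_pt i v) = G (slice_pt i v)" by metis
qed

section \<open>The partial action\<close>

lemma act_mat_1 [simp]: "act (mat 1) W = W"
  by (simp add: act_def)

lemma act_mult: "act (S ** T) W = act S (act T W)"
  by (simp add: act_def image_image matrix_vector_mul_assoc)

lemma mat_1_in_GL2H: "mat 1 \<in> GL2H"
proof -
  have one: "quat_block (\<chi> a b. mat 1 $ (h a :: 2 + 2) $ h b)" if "inj h" for h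
    unfolding quat_block_def using that
    by (intro exI[of _ 1] exI[of _ 0])
       (simp add: vec_eq_iff forall_2 mat_def inj_eq)
  have zero: "quat_block (\<chi> a b. mat 1 $ (h a :: 2 + 2) $ k b)"
    if "\<And>a b. h a \<noteq> k b" for h k
    unfolding quat_block_def using that
    by (intro exI[of _ 0]) (simp add: vec_eq_iff forall_2 mat_def)
  have "invertible (mat 1 :: complex^(2+2)^(2+2))"
    unfolding invertible_def by (intro exI[of _ "mat 1"]) simp
  then show ?thesis by (simp add: GL2H_def one zero)
qed

lemma is_star_unique:
  assumes "i \<in> imag_units" "j \<in> imag_units" "i * j = - (j * i)"
    and "symmetric_slice_domain \<Omega>"
    and "is_star i j \<Omega> T f F" "is_star i j \<Omega> T f G"
  shows "F = G"
  using SR_eq_if_twistor_eq[OF assms(1-4)] assms(5,6) by (simp add: is_star_def)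

theorem corollary5p5:
  fixes i j :: quat and \<Omega> :: "quat set"
  assumes "i \<in> imag_units" and "j \<in> imag_units" and "i * j = - (j * i)"
    and "symmetric_slice_domain \<Omega>"
  shows "(\<forall>f T. star_defined i j \<Omega> T f \<longrightarrow> (\<exists>!F. is_star i j \<Omega> T f F)) \<and>
         (\<forall>f\<in>SR \<Omega>. \<forall>S\<in>GL2H. \<forall>T\<in>GL2H.
            star_defined i j \<Omega> (S ** T) f \<and>
            star_defined i j \<Omega> T f \<and> star_defined i j \<Omega> S (star i j \<Omega> T f) \<longrightarrow>
            star i j \<Omega> (S ** T) f = star i j \<Omega> S (star i j \<Omega> T f)) \<and>
         (\<forall>f\<in>SR \<Omega>. star_defined i j \<Omega> (mat 1) f \<and> star i j \<Omega> (mat 1) f = f)"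
proof -
  note unique = is_star_unique[OF assms]
  have star_eq: "star i j \<Omega> T f = F" if "is_star i j \<Omega> T f F" for T f F
    unfolding star_def
  proof (rule the_equality)
    show "is_star i j \<Omega> T f F" by (fact that)
    show "G = F" if "is_star i j \<Omega> T f G" for G
      using that \<open>is_star i j \<Omega> T f F\<close> by (rule unique)
  qed
  have star: "is_star i j \<Omega> T f (star i j \<Omega> T f)" if "star_defined i j \<Omega> T f" for T f
    using that star_eq unfolding star_defined_def by metis
  have id: "is_star i j \<Omega> (mat 1) f f" if "f \<in> SR \<Omega>" for f
    using that by (simp add: is_star_def)
  show ?thesis
  proof (intro conjI allI ballI impI)
    show "\<exists>!F. is_star i j \<Omega> T f F" if "star_defined i j \<Omega> T f" for f T
      using that unique unfolding star_defined_def by blast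
    show "star i j \<Omega> (S ** T) f = star i j \<Omega> S (star i j \<Omega> T f)"
      if def: "star_defined i j \<Omega> (S ** T) f \<and>
        star_defined i j \<Omega> T f \<and> star_defined i j \<Omega> S (star i j \<Omega> T f)" for f S T
    proof (rule star_eq)
      show "is_star i j \<Omega> (S ** T) f (star i j \<Omega> S (star i j \<Omega> T f))"
        using star[of T f] star[of S "star i j \<Omega> T f"] def
        by (simp add: is_star_def act_mult)
    qed
    show "star_defined i j \<Omega> (mat 1) f" if "f \<in> SR \<Omega>" for f
    proof -
      have "admissible i j \<Omega> (mat 1) f"
        unfolding admissible_def twistor_def U6_def act_mat_1 by blast
      with that id[OF that] mat_1_in_GL2H show ?thesis unfolding star_defined_def by blast
    qed
    show "star i j \<Omega> (mat 1) f = f" if "f \<in> SR \<Omega>" for f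
      using id[OF that] by (rule star_eq)
  qed
qed

end
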